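(* In the single-ADR maintenance problem (the belief-state Markov decision process with parameters $\lambda,c,p,\beta$ and observation densities $Q_{sa}$ described in the context), there exists $b^\ast\in\mathbb{R}$ such that the stationary policy $\pi^\ast:[0,1]\to\{\alpha_0,\alpha_1\}$ given by $$\pi^\ast(b)=\begin{cases}\alpha_1 & \text{if } b\le b^\ast,\\ \alpha_0 & \text{if } b> b^\ast,\end{cases}$$ is optimal, i.e. for every initial belief $b_1\in[0,1]$ it maximizes the total expected discounted profit $V^{\pi}(b_1)$ over all policies $\pi$.
   Context: Single-ADR maintenance problem. An automated demand response device (ADR) is in a state in $\mathcal{S}=\{\gamma_0,\gamma_1\}$ ($\gamma_0$ non-operational, $\gamma_1$ operational). Before each demand response (DR) event $t=1,2,\dots$ the utility picks an action in $\mathcal{A}=\{\alpha_0,\alpha_1\}$ ($\alpha_0$: do nothing; $\alpha_1$: send a crew to reset the ADR). Parameters: $\lambda\ge 0$ (savings when the ADR works), $c\ge 0$ (repair cost), $p\in[0,1]$ (failure probability), $\beta\in(0,1)$ (discount factor). Profits $R_{as}$: $R_{\alpha_0\gamma_0}=0$, $R_{\alpha_0\gamma_1}=\lambda$, $R_{\alpha_1\gamma_0}=R_{\alpha_1\gamma_1}=\lambda-c$. Transition probabilities $P_{ss'}(a)$: $P_{\gamma_0\gamma_0}(\alpha_0)=1$, $P_{\gamma_0\gamma_1}(\alpha_0)=0$, $P_{\gamma_1\gamma_0}(\alpha_0)=p$, $P_{\gamma_1\gamma_1}(\alpha_0)=1-p$; and $P_{s\gamma_0}(\alpha_1)=p$,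 $P_{s\gamma_1}(\alpha_1)=1-p$ for both $s\in\mathcal{S}$. Observations: during DR event $t$ a vector of meter readings $x_t\in\mathcal{X}\subseteq\mathbb{R}^m$ is observed; given $s_t=s$, $a_t=a$, it has probability density $Q_{sa}(\cdot)$ on $\mathcal{X}$ (nonnegative, measurable, integrating to 1). Belief-state MDP: the state is the belief $b\in[0,1]$, the conditional probability that the ADR is operational given the past actions and observations. The expected profits are $r_{\alpha_0}(b)=\lambda b$ and $r_{\alpha_1}(b)=\lambda-c$. Given belief $b$ and action $a$, the observation $x$ has density $W_{ab}(x)=Q_{\gamma_1a}(x)\,b+Q_{\gamma_0a}(x)(1-b)$, and the next belief is $$\Gamma_{ax}(b)=\frac{P_{\gamma_1\gamma_1}(a)Q_{\gamma_1a}(x)\,b+P_{\gamma_0\gamma_1}(a)Q_{\gamma_0a}(x)(1-b)}{W_{ab}(x)}$$ (points $x$ with $W_{ab}(x)=0$ carry no probability and are ignored). For a policy $\pi$, with $a_t^\pi$ the action taken in belief state $b_t$, $V^\pi(b_1)$ denotes the expectation of $\sum_{t=1}^\infty\beta^{t-1}r_{a_t^\pi}(b_t)$, where $b_{t+1}=\Gamma_{a_t^\pi x_t}(b_t)$ and $x_t$ has density $W_{a_t^\pi b_t}$. *)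

theory Defs
  imports "HOL-Probability.Probability"
begin

datatype adr_state = Nonoperational | Operational

datatype adr_action = Do_Nothing | Reset

fun profit :: "real \<Rightarrow> real \<Rightarrow> adr_action \<Rightarrow> adr_state \<Rightarrow> real" where
  "profit lam c Do_Nothing Nonoperational = 0"
| "profit lam c Do_Nothing Operational = lam"
| "profit lam c Reset s = lam - c"

fun trans_prob :: "real \<Rightarrow> adr_action \<Rightarrow> adr_state \<Rightarrow> adr_state \<Rightarrow> real" where
  "trans_prob p Do_Nothing Nonoperational Nonoperational = 1"
| "trans_prob p Do_Nothing Nonoperational Operational = 0"
| "trans_prob p Do_Nothing Operational Nonoperational = p"
| "trans_prob p Do_Nothing Operational Operational = 1 - p"
| "trans_prob p Reset s Nonoperational = p"
| "trans_prob p Reset s Operational = 1 - p"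

definition expected_profit :: "real \<Rightarrow> real \<Rightarrow> adr_action \<Rightarrow> real \<Rightarrow> real" where
  "expected_profit lam c a b = profit lam c a Operational * b + profit lam c a Nonoperational * (1 - b)"

lemma expected_profit_simps [simp]:
  "expected_profit lam c Do_Nothing b = lam * b"
  "expected_profit lam c Reset b = lam - c"
  by (simp_all add: expected_profit_def algebra_simps)

definition obs_density ::
    "(adr_state \<Rightarrow> adr_action \<Rightarrow> 'x \<Rightarrow> real) \<Rightarrow> adr_action \<Rightarrow> real \<Rightarrow> 'x \<Rightarrow> real" where
  "obs_density Q a b x = Q Operational a x * b + Q Nonoperational a x * (1 - b)"

text \<open>Observations of density zero get the next belief \<open>0\<close> (division by zero); they
  carry no probability.\<close>

definition next_belief ::
    "real \<Rightarrow> (adr_state \<Rightarrow> adr_action \<Rightarrow> 'x \<Rightarrow> real) \<Rightarrow> adr_action \<Rightarrow> 'x \<Rightarrow> real \<Rightarrow> real" where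
  "next_belief p Q a x b =
     (trans_prob p a Operational Operational * Q Operational a x * b +
      trans_prob p a Nonoperational Operational * Q Nonoperational a x * (1 - b)) /
     obs_density Q a b x"

text \<open>A trajectory \<open>\<omega>\<close> records at index \<open>t\<close> the action and the observation of the
  \<open>(t + 1)\<close>-st event, so that indices are shifted by one against the informal numbering,
  which starts at \<open>1\<close>. The belief at index \<open>t\<close> depends on the entries of \<open>\<omega>\<close> below
  \<open>t\<close> only.\<close>

primrec belief ::
    "real \<Rightarrow> (adr_state \<Rightarrow> adr_action \<Rightarrow> 'x \<Rightarrow> real) \<Rightarrow> real \<Rightarrow> (nat \<Rightarrow> adr_action \<times> 'x) \<Rightarrow> nat \<Rightarrow> real"
  where
  "belief p Q b\<^sub>1 \<omega> 0 = b\<^sub>1"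
| "belief p Q b\<^sub>1 \<omega> (Suc t) = next_belief p Q (fst (\<omega> t)) (snd (\<omega> t)) (belief p Q b\<^sub>1 \<omega> t)"

text \<open>Policies are history-dependent and may randomize: \<open>\<pi> t b\<^sub>1 \<omega>\<close> is the law of the action at
  index \<open>t\<close>, given the initial belief \<open>b\<^sub>1\<close> and the history \<open>\<omega>\<close>. That only the entries of
  \<open>\<omega>\<close> below \<open>t\<close> are available is ensured in \<open>trajectory_measure\<close> below, where \<open>\<pi> t\<close> is
  applied to elements of the product over \<open>{0..<t}\<close>. Deterministic policies are those whose
  values have the form \<^term>\<open>return_pmf a\<close>.\<close>

type_synonym 'x policy = "nat \<Rightarrow> real \<Rightarrow> (nat \<Rightarrow> adr_action \<times> 'x) \<Rightarrow> adr_action pmf"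

definition step_space :: "'x::euclidean_space set \<Rightarrow> (adr_action \<times> 'x) measure" where
  "step_space X = count_space UNIV \<Otimes>\<^sub>M lebesgue_on X"

definition policies :: "'x::euclidean_space set \<Rightarrow> 'x policy set" where
  "policies X = {\<pi>. \<forall>t. \<forall>b\<^sub>1\<in>{0..1}. \<forall>a.
     (\<lambda>\<omega>. pmf (\<pi> t b\<^sub>1 \<omega>) a) \<in> borel_measurable (PiM {0..<t} (\<lambda>_. step_space X))}"

definition stationary_policy ::
    "real \<Rightarrow> (adr_state \<Rightarrow> adr_action \<Rightarrow> 'x \<Rightarrow> real) \<Rightarrow> (real \<Rightarrow> adr_action) \<Rightarrow> 'x policy" where
  "stationary_policy p Q f = (\<lambda>t b\<^sub>1 \<omega>. return_pmf (f (belief p Q b\<^sub>1 \<omega> t)))"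

text \<open>The joint law of the action and the observation at index \<open>t\<close> given the past: the action is
  drawn from the policy, and then the observation from the density \<^const>\<open>obs_density\<close>.\<close>

definition step_measure ::
    "real \<Rightarrow> 'x::euclidean_space set \<Rightarrow> (adr_state \<Rightarrow> adr_action \<Rightarrow> 'x \<Rightarrow> real) \<Rightarrow> 'x policy \<Rightarrow> real \<Rightarrow>
     nat \<Rightarrow> (nat \<Rightarrow> adr_action \<times> 'x) \<Rightarrow> (adr_action \<times> 'x) measure" where
  "step_measure p X Q \<pi> b\<^sub>1 t \<omega> = density (step_space X)
     (\<lambda>(a, x). ennreal (pmf (\<pi> t b\<^sub>1 \<omega>) a * obs_density Q a (belief p Q b\<^sub>1 \<omega> t) x))"

text \<open>The law of the whole trajectory is the one that the Ionescu-Tulcea theorem builds from the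
  kernels \<^const>\<open>step_measure\<close>.\<close>

definition trajectory_measure ::
    "real \<Rightarrow> 'x::euclidean_space set \<Rightarrow> (adr_state \<Rightarrow> adr_action \<Rightarrow> 'x \<Rightarrow> real) \<Rightarrow> 'x policy \<Rightarrow> real \<Rightarrow>
     (nat \<Rightarrow> adr_action \<times> 'x) measure" where
  "trajectory_measure p X Q \<pi> b\<^sub>1 =
     projective_family.lim UNIV
       (Ionescu_Tulcea.CI (step_measure p X Q \<pi> b\<^sub>1) (\<lambda>_. step_space X)) (\<lambda>_. step_space X)"

definition total_profit ::
    "real \<Rightarrow> real \<Rightarrow> real \<Rightarrow> real \<Rightarrow> 'x::euclidean_space set \<Rightarrow>
     (adr_state \<Rightarrow> adr_action \<Rightarrow> 'x \<Rightarrow> real) \<Rightarrow> 'x policy \<Rightarrow> real \<Rightarrow> real" where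
  "total_profit lam c p \<beta> X Q \<pi> b\<^sub>1 =
     (\<integral>\<omega>. (\<Sum>t. \<beta> ^ t * expected_profit lam c (fst (\<omega> t)) (belief p Q b\<^sub>1 \<omega> t))
       \<partial>trajectory_measure p X Q \<pi> b\<^sub>1)"

definition optimal_policy ::
    "real \<Rightarrow> real \<Rightarrow> real \<Rightarrow> real \<Rightarrow> 'x::euclidean_space set \<Rightarrow>
     (adr_state \<Rightarrow> adr_action \<Rightarrow> 'x \<Rightarrow> real) \<Rightarrow> 'x policy \<Rightarrow> bool" where
  "optimal_policy lam c p \<beta> X Q \<pi> \<longleftrightarrow> \<pi> \<in> policies X \<and>
     (\<forall>b\<^sub>1\<in>{0..1}. \<forall>\<pi>'\<in>policies X.
        total_profit lam c p \<beta> X Q \<pi>' b\<^sub>1 \<le> total_profit lam c p \<beta> X Q \<pi> b\<^sub>1)"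

lemma space_step_space [simp]: "space (step_space X) = UNIV \<times> X"
  by (auto simp: step_space_def space_pair_measure)

lemma UNIV_adr_action: "UNIV = {Do_Nothing, Reset}"
  using adr_action.exhaust by auto

lemma finite_adr_action: "finite (UNIV :: adr_action set)"
  by (simp add: UNIV_adr_action)

lemma sigma_finite_lebesgue_on:
  fixes X :: "'a::euclidean_space set"
  assumes "X \<in> sets lebesgue"
  shows "sigma_finite_measure (lebesgue_on X)"
proof (rule sigma_finite_measure_restrict_space)
  obtain A :: "'a set set" where A: "countable A" "A \<subseteq> sets lborel" "\<Union> A = space lborel"
      "\<forall>a\<in>A. emeasure lborel a \<noteq> \<infinity>"
    using sigma_finite_measure.sigma_finite_countable[OF sigma_finite_lborel] by blast
  show "sigma_finite_measure (lebesgue :: 'a measure)"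
  proof
    show "\<exists>A. countable A \<and> A \<subseteq> sets lebesgue \<and> \<Union> A = space (lebesgue :: 'a measure) \<and>
        (\<forall>a\<in>A. emeasure lebesgue a \<noteq> \<infinity>)"
      using A by (intro exI[of _ A]) (auto simp: emeasure_completion subset_iff)
  qed
qed (use assms in auto)

lemma sigma_finite_step_space:
  assumes "X \<in> sets lebesgue"
  shows "sigma_finite_measure (step_space X)"
  unfolding step_space_def
  by (intro sigma_finite_pair_measure sigma_finite_measure_count_space_finite
      sigma_finite_lebesgue_on assms) (rule finite_adr_action)

lemma measurable_step_space:
  assumes "\<And>a. (\<lambda>x. f a x) \<in> borel_measurable (lebesgue_on X)"
  shows "(\<lambda>z. f (fst z) (snd z)) \<in> borel_measurable (step_space X)"
  unfolding step_space_def
  by (rule measurable_pair_measure_countable1) (use assms in \<open>auto simp: UNIV_adr_action\<close>)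

context
  fixes p :: real and X :: "'x::euclidean_space set"
    and Q :: "adr_state \<Rightarrow> adr_action \<Rightarrow> 'x \<Rightarrow> real"
  assumes p: "0 \<le> p" "p \<le> 1"
    and X: "X \<in> sets lebesgue"
    and Q_nonneg: "\<And>s a x. x \<in> X \<Longrightarrow> 0 \<le> Q s a x"
    and Q_measurable: "\<And>s a. Q s a \<in> borel_measurable (lebesgue_on X)"
    and Q_integral: "\<And>s a. (\<integral>x. Q s a x \<partial>lebesgue_on X) = 1"
begin

lemma obs_density_nonneg:
  "b \<in> {0..1} \<Longrightarrow> x \<in> X \<Longrightarrow> 0 \<le> obs_density Q a b x"
  by (auto simp: obs_density_def Q_nonneg)

lemma nn_integral_obs_density:
  assumes "b \<in> {0..1}"
  shows "(\<integral>\<^sup>+x. ennreal (obs_density Q a b x) \<partial>lebesgue_on X) = 1"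
proof -
  have int: "integrable (lebesgue_on X) (Q s a)" for s
    using Q_integral[of s a] not_integrable_integral_eq[of "lebesgue_on X" "Q s a"] by auto
  have "(\<integral>\<^sup>+x. ennreal (obs_density Q a b x) \<partial>lebesgue_on X) =
      ennreal (\<integral>x. obs_density Q a b x \<partial>lebesgue_on X)"
    using assms int
    by (intro nn_integral_eq_integral) (auto simp: obs_density_def Q_nonneg intro!: AE_I2)
  also have "(\<integral>x. obs_density Q a b x \<partial>lebesgue_on X) = 1"
    unfolding obs_density_def using int by (simp add: Q_integral)
  finally show ?thesis by simp
qed

lemma next_belief_range:
  assumes b: "b \<in> {0..1}" and x: "x \<in> X"
  shows "next_belief p Q a x b \<in> {0..1}"
proof -
  have P: "0 \<le> trans_prob p a s Operational" "trans_prob p a s Operational \<le> 1" for s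
    using p by (cases a; cases s; simp)+
  have Q: "0 \<le> Q Operational a x * b" "0 \<le> Q Nonoperational a x * (1 - b)"
    using b Q_nonneg[OF x] by auto
  have "trans_prob p a Operational Operational * (Q Operational a x * b) +
      trans_prob p a Nonoperational Operational * (Q Nonoperational a x * (1 - b)) \<le> obs_density Q a b x"
    unfolding obs_density_def
    by (intro add_mono mult_left_le_one_le P Q)
  moreover have "0 \<le> trans_prob p a Operational Operational * (Q Operational a x * b) +
      trans_prob p a Nonoperational Operational * (Q Nonoperational a x * (1 - b))"
    by (intro add_nonneg_nonneg mult_nonneg_nonneg P Q)
  ultimately show ?thesis
    by (auto simp: next_belief_def mult.assoc divide_le_eq_1)
qed

lemma belief_range:
  assumes "b\<^sub>1 \<in> {0..1}" and "\<And>i. i < t \<Longrightarrow> snd (\<omega> i) \<in> X"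
  shows "belief p Q b\<^sub>1 \<omega> t \<in> {0..1}"
  using assms(2) by (induction t) (use assms(1) next_belief_range in \<open>auto simp del: atLeastAtMost_iff\<close>)

lemma snd_PiM:
  "\<omega> \<in> space (PiM J (\<lambda>_. step_space X)) \<Longrightarrow> i \<in> J \<Longrightarrow> snd (\<omega> i) \<in> X"
  by (force simp: space_PiM PiE_iff)

lemma measurable_belief:
  assumes "{0..<t} \<subseteq> J"
  shows "(\<lambda>\<omega>. belief p Q b\<^sub>1 \<omega> t) \<in> borel_measurable (PiM J (\<lambda>_. step_space X))"
  using assms
proof (induction t)
  case (Suc t)
  have [measurable]: "(\<lambda>\<omega>. belief p Q b\<^sub>1 \<omega> t) \<in> borel_measurable (PiM J (\<lambda>_. step_space X))"
    by (rule Suc.IH) (use Suc.prems in auto)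
  have t: "(\<lambda>\<omega>. \<omega> t) \<in> measurable (PiM J (\<lambda>_. step_space X)) (step_space X)"
    by (rule measurable_component_singleton) (use Suc.prems in auto)
  have [measurable]: "(\<lambda>\<omega>. f (fst (\<omega> t)) (snd (\<omega> t))) \<in> borel_measurable (PiM J (\<lambda>_. step_space X))"
    if "\<And>a. (\<lambda>x. f a x) \<in> borel_measurable (lebesgue_on X)" for f :: "adr_action \<Rightarrow> 'x \<Rightarrow> real"
    using measurable_compose[OF t measurable_step_space[of f X, OF that]] by simp
  have [measurable]: "(\<lambda>\<omega>. Q s (fst (\<omega> t)) (snd (\<omega> t))) \<in> borel_measurable (PiM J (\<lambda>_. step_space X))"
    "(\<lambda>\<omega>. trans_prob p (fst (\<omega> t)) s Operational) \<in> borel_measurable (PiM J (\<lambda>_. step_space X))" for s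
    using measurable_compose[OF t measurable_step_space[of "Q s" X]]
      measurable_compose[OF t measurable_step_space[of "\<lambda>a _. trans_prob p a s Operational" X]]
      Q_measurable by simp_all
  show ?case
    unfolding belief.simps next_belief_def obs_density_def by measurable
qed simp

lemma measurable_step_density:
  assumes "\<pi> \<in> policies X" and "b\<^sub>1 \<in> {0..1}"
  shows "(\<lambda>(\<omega>, a, x). ennreal (pmf (\<pi> t b\<^sub>1 \<omega>) a * obs_density Q a (belief p Q b\<^sub>1 \<omega> t) x))
    \<in> borel_measurable (PiM {0..<t} (\<lambda>_. step_space X) \<Otimes>\<^sub>M step_space X)" (is "?f \<in> _")
proof -
  let ?H = "PiM {0..<t} (\<lambda>_. step_space X)"
  note [measurable] = measurable_belief[of t "{0..<t}" b\<^sub>1, OF subset_refl]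
  have [measurable]: "(\<lambda>\<omega>. pmf (\<pi> t b\<^sub>1 \<omega>) a) \<in> borel_measurable ?H" for a
    using assms by (auto simp: policies_def)
  have [measurable]: "(\<lambda>z. Q s (fst (snd z)) (snd (snd z))) \<in> borel_measurable (?H \<Otimes>\<^sub>M step_space X)" for s
    using measurable_compose[OF measurable_snd measurable_step_space[of "Q s" X]] Q_measurable by simp
  have [measurable]: "(\<lambda>z. fst (snd z)) \<in> measurable (?H \<Otimes>\<^sub>M step_space X) (count_space UNIV)"
    unfolding step_space_def by measurable
  have [measurable]: "(\<lambda>z. pmf (\<pi> t b\<^sub>1 (fst z)) (fst (snd z))) \<in> borel_measurable (?H \<Otimes>\<^sub>M step_space X)"
    by (rule measurable_compose_countable'[where I = UNIV and g = "\<lambda>z. fst (snd z)"])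
       (auto intro!: countable_finite simp: finite_adr_action)
  show ?thesis
    unfolding obs_density_def case_prod_beta by measurable
qed

lemma prob_space_step_measure:
  assumes "\<pi> \<in> policies X" and "b\<^sub>1 \<in> {0..1}" and \<omega>: "\<omega> \<in> space (PiM {0..<t} (\<lambda>_. step_space X))"
  shows "prob_space (step_measure p X Q \<pi> b\<^sub>1 t \<omega>)"
proof
  interpret sigma_finite_measure "lebesgue_on X"
    by (rule sigma_finite_lebesgue_on[OF X])
  let ?b = "belief p Q b\<^sub>1 \<omega> t"
  let ?f = "\<lambda>(a, x). ennreal (pmf (\<pi> t b\<^sub>1 \<omega>) a * obs_density Q a ?b x)"
  have b: "?b \<in> {0..1}"
    using assms snd_PiM[OF \<omega>] by (intro belief_range) auto
  have f: "?f \<in> borel_measurable (step_space X)"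
    using measurable_compose[OF measurable_Pair1'[OF \<omega>] measurable_step_density[OF assms(1,2)]]
    by simp
  have [measurable]: "obs_density Q a ?b \<in> borel_measurable (lebesgue_on X)" for a
    unfolding obs_density_def[abs_def] using Q_measurable by measurable
  have "emeasure (step_measure p X Q \<pi> b\<^sub>1 t \<omega>) (space (step_measure p X Q \<pi> b\<^sub>1 t \<omega>)) =
      (\<integral>\<^sup>+z. ?f z \<partial>step_space X)"
    unfolding step_measure_def using f
    by (subst emeasure_density) (auto intro!: nn_integral_cong simp del: space_step_space)
  also have "\<dots> = (\<integral>\<^sup>+a. \<integral>\<^sup>+x. ?f (a, x) \<partial>lebesgue_on X \<partial>count_space UNIV)"
    using f unfolding step_space_def by (rule nn_integral_fst[symmetric])
  also have "\<dots> = (\<integral>\<^sup>+a. ennreal (pmf (\<pi> t b\<^sub>1 \<omega>) a) \<partial>count_space UNIV)"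
    using nn_integral_obs_density[OF b]
    by (intro nn_integral_cong) (simp add: ennreal_mult' nn_integral_cmult)
  also have "\<dots> = 1"
    by (simp add: nn_integral_pmf)
  finally show "emeasure (step_measure p X Q \<pi> b\<^sub>1 t \<omega>) (space (step_measure p X Q \<pi> b\<^sub>1 t \<omega>)) = 1" .
qed

text \<open>This is what makes \<^const>\<open>trajectory_measure\<close> meaningful: the defining equations of the
  limit measure are available only for kernels in the locale \<open>Ionescu_Tulcea\<close>.\<close>

lemma Ionescu_Tulcea_step_measure:
  assumes "\<pi> \<in> policies X" and "b\<^sub>1 \<in> {0..1}"
  shows "Ionescu_Tulcea (step_measure p X Q \<pi> b\<^sub>1) (\<lambda>_. step_space X)"
proof (rule Ionescu_Tulcea.intro)
  fix t :: nat
  interpret sigma_finite_measure "step_space X"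
    by (rule sigma_finite_step_space[OF X])
  let ?H = "PiM {0..<t} (\<lambda>_. step_space X)"
  note [measurable] = measurable_step_density[OF assms, of t]
  show "step_measure p X Q \<pi> b\<^sub>1 t \<in> measurable ?H (subprob_algebra (step_space X))"
  proof (rule measurable_subprob_algebra)
    fix A assume A[measurable]: "A \<in> sets (step_space X)"
    have "emeasure (step_measure p X Q \<pi> b\<^sub>1 t \<omega>) A =
        (\<integral>\<^sup>+z. (\<lambda>(\<omega>, a, x). ennreal (pmf (\<pi> t b\<^sub>1 \<omega>) a * obs_density Q a (belief p Q b\<^sub>1 \<omega> t) x)) (\<omega>, z)
           * indicator A z \<partial>step_space X)" if "\<omega> \<in> space ?H" for \<omega>
      unfolding step_measure_def
      using measurable_compose[OF measurable_Pair1'[OF that] measurable_step_density[OF assms]]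
      by (subst emeasure_density) auto
    then show "(\<lambda>\<omega>. emeasure (step_measure p X Q \<pi> b\<^sub>1 t \<omega>) A) \<in> borel_measurable ?H"
      by (subst measurable_cong, assumption) measurable
  qed (auto simp: step_measure_def intro!: prob_space_imp_subprob_space
      prob_space_step_measure[OF assms, unfolded step_measure_def])
qed (rule prob_space_step_measure[OF assms])

lemma stationary_policy_in_policies:
  assumes [measurable]: "f \<in> measurable borel (count_space UNIV)"
  shows "stationary_policy p Q f \<in> policies X"
proof -
  note [measurable] = measurable_belief[OF subset_refl]
  show ?thesis
    unfolding policies_def stationary_policy_def by (simp add: pmf_return indicator_def)
qed

end

end

theory Submission
  imports Defs
begin

text \<open>
  Resetting has the same value \<open>K\<close> for every belief, because the belief afterwards is \<open>1 - p\<close>.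
  Doing nothing has a convex value \<open>h\<close>, because value iteration preserves convexity. Hence
  \<open>{b. h b \<le> K}\<close> is an interval. If \<open>K < 0\<close> it is empty, as \<open>h \<ge> 0\<close>. If \<open>K \<ge> 0\<close> it
  contains \<open>0\<close>, a belief that doing nothing preserves, so that \<open>h 0 = \<beta> K\<close>. It is closed on the
  right: the value function on unnormalized beliefs is monotone and subadditive, which bounds the
  increase of \<open>h\<close> linearly.
\<close>

section \<open>Expectations under the Ionescu-Tulcea measure\<close>

text \<open>The marginal of the limit on a finite index set \<open>J\<close> is \<open>CI J\<close>,
  which runs \<open>C\<close> up to the least bound of \<open>J\<close> and restricts to
  \<open>J\<close>. For an initial segment that bound is \<open>n\<close> and the restriction is the
  identity.\<close>

lemma (in Ionescu_Tulcea) distr_lim_C: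
  "distr PF.lim (PiM {0..<n} M) (\<lambda>\<omega>. restrict \<omega> {0..<n}) = C 0 n (\<lambda>_. undefined)"
proof -
  have n: "up_to {0..<n} = n"
    unfolding up_to_def by (rule Least_equality) (auto simp: not_le[symmetric])
  have [simp]: "(\<lambda>_. undefined) \<in> space (PiM {0..<0::nat} M)"
    by (simp add: space_PiM)
  have "distr (C 0 n (\<lambda>_. undefined)) (PiM {0..<n} M) (\<lambda>\<omega>. restrict \<omega> {0..<n}) =
      distr (C 0 n (\<lambda>_. undefined)) (C 0 n (\<lambda>_. undefined)) (\<lambda>\<omega>. \<omega>)"
    by (rule distr_cong) (simp_all add: sets_C space_C space_PiM)
  then show ?thesis
    by (simp add: distr_lim CI_def n distr_id[unfolded id_def])
qed

text \<open>Reduces an expectation under the limit measure to one step of the kernel. A function of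
  the first \<open>Suc n\<close> coordinates sees only \<open>C 0 (Suc n)\<close>, which is
  \<open>C 0 n\<close> bound to \<open>eP n\<close>, and \<open>eP n\<close> is the image of
  \<open>P n\<close> under appending a coordinate.\<close>

lemma (in Ionescu_Tulcea) integral_lim_Suc:
  fixes f :: "(nat \<Rightarrow> 'a) \<Rightarrow> real"
  assumes f [measurable]: "f \<in> borel_measurable (PiM {0..<Suc n} M)"
    and bound: "\<And>\<omega>. \<omega> \<in> space (PiM {0..<Suc n} M) \<Longrightarrow> \<bar>f \<omega>\<bar> \<le> B"
    and restrict: "\<And>\<omega>. f (restrict \<omega> {0..<Suc n}) = f \<omega>"
  shows "(\<integral>\<omega>. f \<omega> \<partial>PF.lim) =
    (\<integral>\<omega>. (\<integral>z. f (fun_upd \<omega> n z) \<partial>P n \<omega>) \<partial>C 0 n (\<lambda>_. undefined))"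
proof -
  have start [simp]: "(\<lambda>_. undefined) \<in> space (PiM {0..<0::nat} M)"
    by (simp add: space_PiM)
  interpret C: prob_space "C 0 n (\<lambda>_. undefined)"
    by (rule prob_space_C) simp
  have "(\<integral>\<omega>. f \<omega> \<partial>PF.lim) = (\<integral>\<omega>. f (restrict \<omega> {0..<Suc n}) \<partial>PF.lim)"
    by (simp only: restrict)
  also have "\<dots> = (\<integral>\<omega>. f \<omega> \<partial>C 0 (Suc n) (\<lambda>_. undefined))"
    unfolding distr_lim_C[symmetric]
    by (rule integral_distr[symmetric]) (auto simp: measurable_cong_sets[OF PF.sets_lim refl]
        simp del: restrict_apply intro!: measurable_restrict_subset)
  also have "\<dots> = (\<integral>\<omega>. f \<omega> \<partial>(C 0 n (\<lambda>_. undefined) \<bind> eP n))"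
    by simp
  also have "\<dots> = (\<integral>\<omega>. (\<integral>\<omega>'. f \<omega>' \<partial>eP n \<omega>) \<partial>C 0 n (\<lambda>_. undefined))"
  proof (rule integral_bind[where K = "PiM {0..<Suc n} M" and B = B and B' = 1])
    show "eP n \<in> measurable (C 0 n (\<lambda>_. undefined)) (subprob_algebra (PiM {0..<Suc n} M))"
      using measurable_eP[of n] by (simp add: measurable_cong_sets[OF sets_C refl])
    show "AE x in C 0 n (\<lambda>_. undefined). emeasure (eP n x) (space (eP n x)) \<le> ennreal 1"
      by (auto simp: space_C intro!: AE_I2 prob_space.emeasure_le_1 prob_space_eP)
  qed (use bound in \<open>auto intro: C.finite_measure_axioms\<close>)
  also have "\<dots> = (\<integral>\<omega>. (\<integral>z. f (fun_upd \<omega> n z) \<partial>P n \<omega>) \<partial>C 0 n (\<lambda>_. undefined))"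
  proof (rule Bochner_Integration.integral_cong[OF refl])
    fix \<omega> assume "\<omega> \<in> space (C 0 n (\<lambda>_. undefined))"
    then have \<omega>: "\<omega> \<in> space (PiM {0..<n} M)"
      by (simp add: space_C)
    then have "fun_upd \<omega> n \<in> measurable (P n \<omega>) (PiM {0..<Suc n} M)"
      by (intro measurable_fun_upd[where J = "{0..<n}"])
         (auto simp: measurable_cong_sets[OF sets_P[OF \<omega>] refl])
    then show "(\<integral>\<omega>'. f \<omega>' \<partial>eP n \<omega>) = (\<integral>z. f (fun_upd \<omega> n z) \<partial>P n \<omega>)"
      unfolding eP_def by (rule integral_distr) (rule f)
  qed
  finally show ?thesis .
qed

text \<open>Images preserve total mass, so it can be read off the projection onto no coordinates,
  which is the probability measure \<open>C 0 0\<close>.\<close>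

lemma (in Ionescu_Tulcea) prob_space_lim: "prob_space PF.lim"
proof (rule prob_space_distrD)
  show "prob_space (distr PF.lim (PiM {0..<0} M) (\<lambda>\<omega>. restrict \<omega> {0..<0}))"
    unfolding distr_lim_C by (rule prob_space_C) (simp add: space_PiM)
  show "(\<lambda>\<omega>. restrict \<omega> {0..<0}) \<in> measurable PF.lim (PiM {0..<0} M)"
    by (simp add: measurable_cong_sets[OF PF.sets_lim refl] measurable_restrict_subset)
qed

section \<open>The value function\<close>

lemma belief_cong:
  assumes "\<And>i. i < t \<Longrightarrow> \<omega> i = \<omega>' i"
  shows "belief p Q b \<omega> t = belief p Q b \<omega>' t"
  using assms by (induction t) auto

locale adr_maintenance =
  fixes lam c p \<beta> :: real
    and X :: "'x::euclidean_space set"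
    and Q :: "adr_state \<Rightarrow> adr_action \<Rightarrow> 'x \<Rightarrow> real"
  assumes lam: "0 \<le> lam" and c: "0 \<le> c" and p: "0 \<le> p" "p \<le> 1" and \<beta>: "0 < \<beta>" "\<beta> < 1"
    and X: "X \<in> sets lebesgue"
    and Q_nonneg: "\<And>s a x. x \<in> X \<Longrightarrow> 0 \<le> Q s a x"
    and Q_measurable [measurable]: "\<And>s a. Q s a \<in> borel_measurable (lebesgue_on X)"
    and Q_integral: "\<And>s a. (\<integral>x. Q s a x \<partial>lebesgue_on X) = 1"
begin

abbreviation "M \<equiv> lebesgue_on X"
abbreviation "q0 \<equiv> Q Nonoperational Do_Nothing"
abbreviation "q1 \<equiv> Q Operational Do_Nothing"

text \<open>The discounted sum of \<open>lam\<close>, the largest profit that a single event can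
  yield.\<close>

definition value_bound :: real where
  "value_bound = lam / (1 - \<beta>)"

text \<open>Values of unnormalized beliefs, with weight \<open>u\<close> on the non-operational and \<open>w\<close> on the
  operational state. Value functions are extended homogeneously, which removes the division by the
  density in \<^const>\<open>next_belief\<close> and turns convexity into subadditivity.\<close>

definition wait :: "(real \<Rightarrow> real \<Rightarrow> real) \<Rightarrow> real \<Rightarrow> real \<Rightarrow> real" where
  "wait G u w = lam * w + \<beta> * (\<integral>x. G (q0 x * u + p * q1 x * w) ((1 - p) * q1 x * w) \<partial>M)"

definition repair :: "(real \<Rightarrow> real \<Rightarrow> real) \<Rightarrow> real" where
  "repair G = lam - c + \<beta> * G p (1 - p)"

text \<open>\<open>repair G\<close> is the value of resetting at total mass 1; the factor
  \<open>u + w\<close> extends it homogeneously.\<close>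

definition bellman :: "(real \<Rightarrow> real \<Rightarrow> real) \<Rightarrow> real \<Rightarrow> real \<Rightarrow> real" where
  "bellman G u w = max (wait G u w) ((u + w) * repair G)"

text \<open>The invariant of value iteration. Homogeneity and subadditivity encode convexity in the
  normalized belief; nonnegativity and the bound supply integrability and convergence; monotonicity
  helps to close the sublevel set at its right end. The inequalities are confined to the nonnegative
  quadrant, where unnormalized beliefs live.\<close>

definition sublinear_value :: "(real \<Rightarrow> real \<Rightarrow> real) \<Rightarrow> bool" where
  "sublinear_value G \<longleftrightarrow>
     (\<lambda>(u, w). G u w) \<in> borel_measurable (borel \<Otimes>\<^sub>M borel) \<and>
     (\<forall>u\<ge>0. \<forall>w\<ge>0. 0 \<le> G u w \<and> G u w \<le> value_bound * (u + w) \<and>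
        (\<forall>k\<ge>0. G (k * u) (k * w) = k * G u w) \<and>
        (\<forall>u'\<ge>0. \<forall>w'\<ge>0. G (u + u') (w + w') \<le> G u w + G u' w') \<and>
        (\<forall>u'\<ge>u. \<forall>w'\<ge>w. G u w \<le> G u' w'))"

lemma
  assumes "sublinear_value G"
  shows sublinear_measurable: "(\<lambda>(u, w). G u w) \<in> borel_measurable (borel \<Otimes>\<^sub>M borel)"
    and sublinear_nonneg: "0 \<le> u \<Longrightarrow> 0 \<le> w \<Longrightarrow> 0 \<le> G u w"
    and sublinear_bound: "0 \<le> u \<Longrightarrow> 0 \<le> w \<Longrightarrow> G u w \<le> value_bound * (u + w)"
    and sublinear_scale: "0 \<le> u \<Longrightarrow> 0 \<le> w \<Longrightarrow> 0 \<le> k \<Longrightarrow> G (k * u) (k * w) = k * G u w"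
    and sublinear_add: "0 \<le> u \<Longrightarrow> 0 \<le> w \<Longrightarrow> 0 \<le> u' \<Longrightarrow> 0 \<le> w' \<Longrightarrow> G (u + u') (w + w') \<le> G u w + G u' w'"
    and sublinear_mono: "0 \<le> u \<Longrightarrow> 0 \<le> w \<Longrightarrow> u \<le> u' \<Longrightarrow> w \<le> w' \<Longrightarrow> G u w \<le> G u' w'"
  using assms by (auto simp: sublinear_value_def)

lemma sublinear_valueI:
  assumes "(\<lambda>(u, w). G u w) \<in> borel_measurable (borel \<Otimes>\<^sub>M borel)"
    and "\<And>u w. 0 \<le> u \<Longrightarrow> 0 \<le> w \<Longrightarrow> 0 \<le> G u w"
    and "\<And>u w. 0 \<le> u \<Longrightarrow> 0 \<le> w \<Longrightarrow> G u w \<le> value_bound * (u + w)"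
    and "\<And>u w k. 0 \<le> u \<Longrightarrow> 0 \<le> w \<Longrightarrow> 0 \<le> k \<Longrightarrow> G (k * u) (k * w) = k * G u w"
    and "\<And>u w u' w'. 0 \<le> u \<Longrightarrow> 0 \<le> w \<Longrightarrow> 0 \<le> u' \<Longrightarrow> 0 \<le> w' \<Longrightarrow>
      G (u + u') (w + w') \<le> G u w + G u' w'"
    and "\<And>u w u' w'. 0 \<le> u \<Longrightarrow> 0 \<le> w \<Longrightarrow> u \<le> u' \<Longrightarrow> w \<le> w' \<Longrightarrow> G u w \<le> G u' w'"
  shows "sublinear_value G"
  unfolding sublinear_value_def by (intro conjI allI impI assms)

section \<open>The Bellman operator preserves sublinearity\<close>

lemma value_bound_nonneg: "0 \<le> value_bound"
  using lam \<beta> by (simp add: value_bound_def)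

text \<open>The fixed-point identity that lets one Bellman step reproduce the same bound.\<close>

lemma value_bound_fixed: "lam + \<beta> * value_bound = value_bound"
  using \<beta> by (simp add: value_bound_def field_simps)

text \<open>A non-integrable function has integral 0 by convention, so integral 1 already gives
  integrability.\<close>

lemma Q_integrable [simp]: "integrable M (Q s a)"
  using Q_integral[of s a] not_integrable_integral_eq[of M "Q s a"] by auto

lemma wait_arguments_nonneg:
  assumes "x \<in> space M" "0 \<le> u" "0 \<le> w"
  shows "0 \<le> q0 x * u + p * q1 x * w" "0 \<le> (1 - p) * q1 x * w"
  using assms p Q_nonneg[of x] by auto

lemma measurable_wait_integrand:
  assumes "sublinear_value G"
  shows "(\<lambda>x. G (q0 x * u + p * q1 x * w) ((1 - p) * q1 x * w)) \<in> borel_measurable M"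
  using measurable_compose[OF _ sublinear_measurable[OF assms],
      of "\<lambda>x. (q0 x * u + p * q1 x * w, (1 - p) * q1 x * w)" M]
  by simp

text \<open>The two weights add up to \<open>q0 x * u + q1 x * w\<close>, since the shares
  \<open>p\<close> and \<open>1 - p\<close> of the operational mass recombine. This gives the
  integrable majorant for the integral in \<open>wait\<close>.\<close>

lemma wait_integrand_bound:
  assumes "sublinear_value G" "x \<in> space M" "0 \<le> u" "0 \<le> w"
  shows "G (q0 x * u + p * q1 x * w) ((1 - p) * q1 x * w) \<le> value_bound * (q0 x * u + q1 x * w)"
  using sublinear_bound[OF assms(1) wait_arguments_nonneg[OF assms(2-4)]]
  by (simp add: algebra_simps)

lemma integral_bound: "(\<integral>x. value_bound * (q0 x * u + q1 x * w) \<partial>M) = value_bound * (u + w)"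
  by (simp add: Q_integral)

lemma integrable_wait:
  assumes "sublinear_value G" "0 \<le> u" "0 \<le> w"
  shows "integrable M (\<lambda>x. G (q0 x * u + p * q1 x * w) ((1 - p) * q1 x * w))"
proof (rule Bochner_Integration.integrable_bound)
  show "integrable M (\<lambda>x. value_bound * (q0 x * u + q1 x * w))"
    by simp
  show "AE x in M. norm (G (q0 x * u + p * q1 x * w) ((1 - p) * q1 x * w)) \<le>
      norm (value_bound * (q0 x * u + q1 x * w))"
    using wait_integrand_bound[OF assms(1) _ assms(2,3)]
      sublinear_nonneg[OF assms(1) wait_arguments_nonneg] assms(2,3)
    by (intro AE_I2) (fastforce intro: order_trans[OF _ abs_ge_self])
qed (rule measurable_wait_integrand[OF assms(1)])

lemma wait_nonneg:
  assumes "sublinear_value G" "0 \<le> u" "0 \<le> w"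
  shows "0 \<le> wait G u w"
  unfolding wait_def using assms \<beta> lam
  by (intro add_nonneg_nonneg mult_nonneg_nonneg integral_nonneg_AE AE_I2
      sublinear_nonneg[OF assms(1)] wait_arguments_nonneg) auto

lemma wait_bound:
  assumes "sublinear_value G" "0 \<le> u" "0 \<le> w"
  shows "wait G u w \<le> value_bound * (u + w)"
proof -
  have "(\<integral>x. G (q0 x * u + p * q1 x * w) ((1 - p) * q1 x * w) \<partial>M) \<le>
      (\<integral>x. value_bound * (q0 x * u + q1 x * w) \<partial>M)"
    by (intro integral_mono integrable_wait assms wait_integrand_bound) auto
  then have "wait G u w \<le> lam * w + \<beta> * (value_bound * (u + w))"
    unfolding wait_def integral_bound using \<beta> by (intro add_left_mono mult_left_mono) auto
  \<comment> \<open>Enlarging \<open>lam * w\<close> to \<open>lam * (u + w)\<close> makes the bound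
    a multiple of the total mass, ready for the fixed-point identity.\<close>
  also have "\<dots> \<le> (lam + \<beta> * value_bound) * (u + w)"
    using lam assms by (simp add: algebra_simps)
  finally show ?thesis
    by (simp add: value_bound_fixed)
qed

lemma wait_scale:
  assumes "sublinear_value G" "0 \<le> u" "0 \<le> w" "0 \<le> k"
  shows "wait G (k * u) (k * w) = k * wait G u w"
proof -
  have "(\<integral>x. G (q0 x * (k * u) + p * q1 x * (k * w)) ((1 - p) * q1 x * (k * w)) \<partial>M) =
      (\<integral>x. k * G (q0 x * u + p * q1 x * w) ((1 - p) * q1 x * w) \<partial>M)"
  proof (rule Bochner_Integration.integral_cong[OF refl])
    fix x assume "x \<in> space M"
    from sublinear_scale[OF assms(1) wait_arguments_nonneg[OF this assms(2,3)] assms(4)]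
    show "G (q0 x * (k * u) + p * q1 x * (k * w)) ((1 - p) * q1 x * (k * w)) =
        k * G (q0 x * u + p * q1 x * w) ((1 - p) * q1 x * w)"
      by (simp add: algebra_simps)
  qed
  then show ?thesis
    by (simp add: wait_def algebra_simps)
qed

lemma wait_add:
  assumes G: "sublinear_value G" and u: "0 \<le> u" "0 \<le> w" "0 \<le> u'" "0 \<le> w'"
  shows "wait G (u + u') (w + w') \<le> wait G u w + wait G u' w'"
proof -
  let ?g = "\<lambda>u w x. G (q0 x * u + p * q1 x * w) ((1 - p) * q1 x * w)"
  have "(\<integral>x. ?g (u + u') (w + w') x \<partial>M) \<le> (\<integral>x. ?g u w x + ?g u' w' x \<partial>M)"
  proof (rule integral_mono)
    fix x assume x: "x \<in> space M"
    show "?g (u + u') (w + w') x \<le> ?g u w x + ?g u' w' x"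
      using sublinear_add[OF G wait_arguments_nonneg[OF x u(1,2)] wait_arguments_nonneg[OF x u(3,4)]]
      by (simp add: algebra_simps)
  qed (use u in \<open>auto intro!: integrable_wait G\<close>)
  also have "\<dots> = (\<integral>x. ?g u w x \<partial>M) + (\<integral>x. ?g u' w' x \<partial>M)"
    by (intro Bochner_Integration.integral_add integrable_wait G u)
  finally have "\<beta> * (\<integral>x. ?g (u + u') (w + w') x \<partial>M) \<le>
      \<beta> * ((\<integral>x. ?g u w x \<partial>M) + (\<integral>x. ?g u' w' x \<partial>M))"
    using \<beta> by (intro mult_left_mono) auto
  then show ?thesis
    by (simp add: wait_def distrib_left)
qed

lemma wait_mono:
  assumes G: "sublinear_value G" and u: "0 \<le> u" "0 \<le> w" "u \<le> u'" "w \<le> w'"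
  shows "wait G u w \<le> wait G u' w'"
proof -
  have "G (q0 x * u + p * q1 x * w) ((1 - p) * q1 x * w) \<le>
      G (q0 x * u' + p * q1 x * w') ((1 - p) * q1 x * w')" if x: "x \<in> space M" for x
    using p u x Q_nonneg[of x]
    by (intro sublinear_mono[OF G] wait_arguments_nonneg add_mono mult_left_mono) auto
  then show ?thesis
    unfolding wait_def using u lam \<beta>
    by (intro add_mono mult_left_mono integral_mono integrable_wait G) auto
qed

lemma wait_le_wait:
  assumes "sublinear_value G" "sublinear_value H"
    and "\<And>u w. 0 \<le> u \<Longrightarrow> 0 \<le> w \<Longrightarrow> G u w \<le> H u w" and "0 \<le> u" "0 \<le> w"
  shows "wait G u w \<le> wait H u w"
  unfolding wait_def using \<beta> assms
  by (intro add_left_mono mult_left_mono integral_mono integrable_wait)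
     (auto intro!: assms(3) wait_arguments_nonneg)

lemma bellman_le_bellman:
  assumes "sublinear_value G" "sublinear_value H"
    and "\<And>u w. 0 \<le> u \<Longrightarrow> 0 \<le> w \<Longrightarrow> G u w \<le> H u w" and "0 \<le> u" "0 \<le> w"
  shows "bellman G u w \<le> bellman H u w"
  unfolding bellman_def repair_def using p \<beta> assms
  by (intro max.mono wait_le_wait mult_left_mono add_left_mono) auto

lemma measurable_wait:
  assumes "sublinear_value G"
  shows "(\<lambda>(u, w). wait G u w) \<in> borel_measurable (borel \<Otimes>\<^sub>M borel)"
proof -
  \<comment> \<open>Sigma-finiteness makes an integral over \<open>M\<close> depend measurably on
    its parameters.\<close>
  interpret sigma_finite_measure M
    by (rule sigma_finite_lebesgue_on[OF X])
  have [measurable]: "(\<lambda>z. G (fst z) (snd z)) \<in> borel_measurable (borel \<Otimes>\<^sub>M borel)"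
    using sublinear_measurable[OF assms] by (simp add: case_prod_beta)
  have "(\<lambda>z. (\<lambda>z. G (fst z) (snd z))
        (q0 (snd z) * fst (fst z) + p * q1 (snd z) * snd (fst z), (1 - p) * q1 (snd z) * snd (fst z)))
      \<in> borel_measurable ((borel \<Otimes>\<^sub>M borel) \<Otimes>\<^sub>M M)"
    by measurable
  then have [measurable]: "(\<lambda>(z, x). G (q0 x * fst z + p * q1 x * snd z) ((1 - p) * q1 x * snd z))
      \<in> borel_measurable ((borel \<Otimes>\<^sub>M borel) \<Otimes>\<^sub>M M)"
    by (simp add: case_prod_beta)
  show ?thesis
    unfolding wait_def case_prod_beta by measurable
qed

text \<open>The reset value \<open>(u + w) * repair G\<close> is linear in the weights, so its
  maximum with the sublinear \<open>wait G\<close> stays homogeneous and subadditive. Only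
  monotonicity depends on the sign of \<open>repair G\<close>.\<close>

lemma sublinear_bellman:
  assumes G: "sublinear_value G"
  shows "sublinear_value (bellman G)"
proof (rule sublinear_valueI)
  show "(\<lambda>(u, w). bellman G u w) \<in> borel_measurable (borel \<Otimes>\<^sub>M borel)"
    using measurable_wait[OF G] unfolding bellman_def case_prod_beta by measurable
  show "0 \<le> bellman G u w" if "0 \<le> u" "0 \<le> w" for u w
    unfolding bellman_def using wait_nonneg[OF G that] by auto
  show "bellman G u w \<le> value_bound * (u + w)" if "0 \<le> u" "0 \<le> w" for u w
  proof -
    have "repair G \<le> lam + \<beta> * value_bound"
      unfolding repair_def using sublinear_bound[OF G, of p "1 - p"] p c \<beta>
      by (intro add_mono mult_left_mono) auto
    then have "(u + w) * repair G \<le> (u + w) * value_bound"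
      unfolding value_bound_fixed using that by (intro mult_left_mono) auto
    then show ?thesis
      unfolding bellman_def using wait_bound[OF G that] by (simp add: mult.commute)
  qed
  show "bellman G (k * u) (k * w) = k * bellman G u w" if "0 \<le> u" "0 \<le> w" "0 \<le> k" for k u w
    unfolding bellman_def wait_scale[OF G that] distrib_left[symmetric] mult.assoc
    using that(3) by (simp add: max_mult_distrib_left)
  show "bellman G (u + u') (w + w') \<le> bellman G u w + bellman G u' w'"
    if "0 \<le> u" "0 \<le> w" "0 \<le> u'" "0 \<le> w'" for u w u' w'
  proof -
    have "(u + u' + (w + w')) * repair G = (u + w) * repair G + (u' + w') * repair G"
      by (simp add: algebra_simps)
    then show ?thesis
      unfolding bellman_def using wait_add[OF G that] by linarith
  qed
  show "bellman G u w \<le> bellman G u' w'"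
    if u: "0 \<le> u" "0 \<le> w" "u \<le> u'" "w \<le> w'" for u w u' w'
  proof (cases "0 \<le> repair G")
    case True
    then show ?thesis
      unfolding bellman_def using u wait_mono[OF G u]
      by (intro max.mono mult_right_mono) auto
  next
    \<comment> \<open>A negative reset value falls as the mass grows, but it lies below the
      nonnegative value of waiting. So the maximum at \<open>(u, w)\<close> is the value of waiting,
      which is monotone.\<close>
    case False
    then have "(u + w) * repair G \<le> wait G u w"
      using wait_nonneg[OF G u(1,2)] u by (meson add_nonneg_nonneg mult_nonneg_nonpos nle_le order_trans)
    then show ?thesis
      unfolding bellman_def using wait_mono[OF G u] by linarith
  qed
qed

section \<open>Value iteration and its limit\<close>

primrec iterate :: "nat \<Rightarrow> real \<Rightarrow> real \<Rightarrow> real" where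
  "iterate 0 = (\<lambda>u w. 0)"
| "iterate (Suc n) = bellman (iterate n)"

lemma sublinear_iterate: "sublinear_value (iterate n)"
proof (induction n)
  case 0
  show ?case
    using value_bound_nonneg by (simp add: sublinear_value_def)
qed (simp add: sublinear_bellman)

text \<open>The start 0 lies below its image because values are nonnegative; monotonicity of
  \<open>bellman\<close> in its function argument propagates this to every step.\<close>

lemma iterate_le_Suc: "0 \<le> u \<Longrightarrow> 0 \<le> w \<Longrightarrow> iterate n u w \<le> iterate (Suc n) u w"
proof (induction n arbitrary: u w)
  case 0
  then show ?case
    using sublinear_nonneg[OF sublinear_iterate[of "Suc 0"]] by simp
next
  case (Suc n)
  show ?case
    unfolding iterate.simps(2)[of "Suc n"] iterate.simps(2)[of n]
    using bellman_le_bellman[OF sublinear_iterate sublinear_iterate Suc.IH Suc.prems] by simp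
qed

definition opt_value :: "real \<Rightarrow> real \<Rightarrow> real" where
  "opt_value u w = lim (\<lambda>n. iterate n u w)"

text \<open>The iterates increase and stay below \<open>value_bound * (u + w)\<close>.\<close>

lemma iterate_LIMSEQ:
  assumes "0 \<le> u" "0 \<le> w"
  shows "(\<lambda>n. iterate n u w) \<longlonglongrightarrow> opt_value u w"
  unfolding opt_value_def convergent_LIMSEQ_iff[symmetric]
proof (rule Bseq_monoseq_convergent)
  show "Bseq (\<lambda>n. iterate n u w)"
    using sublinear_nonneg[OF sublinear_iterate] sublinear_bound[OF sublinear_iterate] assms
    by (intro BseqI'[of _ "value_bound * (u + w)"]) auto
  show "monoseq (\<lambda>n. iterate n u w)"
    using iterate_le_Suc assms by (simp add: monoseq_Suc)
qed

text \<open>Every clause other than measurability is an equation or a weak inequality that holds for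
  all iterates, hence it survives the pointwise limit.\<close>

lemma sublinear_opt: "sublinear_value opt_value"
proof (rule sublinear_valueI)
  note sub = sublinear_iterate and lim = iterate_LIMSEQ
  \<comment> \<open>\<open>lim\<close> of measurable functions is measurable on the whole plane,
    even at points where the iterates may fail to converge.\<close>
  show "(\<lambda>(u, w). opt_value u w) \<in> borel_measurable (borel \<Otimes>\<^sub>M borel)"
    using sublinear_measurable[OF sub] unfolding opt_value_def case_prod_beta
    by (intro borel_measurable_lim_metric)
  show "0 \<le> opt_value u w" if "0 \<le> u" "0 \<le> w" for u w
    using that sublinear_nonneg[OF sub] by (intro LIMSEQ_le_const[OF lim]) auto
  show "opt_value u w \<le> value_bound * (u + w)" if "0 \<le> u" "0 \<le> w" for u w
    using that sublinear_bound[OF sub] by (intro LIMSEQ_le_const2[OF lim]) auto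
  show "opt_value (k * u) (k * w) = k * opt_value u w" if "0 \<le> u" "0 \<le> w" "0 \<le> k" for k u w
    using that lim[of "k * u" "k * w"] tendsto_mult_left[OF lim[of u w], of k]
    by (intro LIMSEQ_unique[of "\<lambda>n. iterate n (k * u) (k * w)"]) (auto simp: sublinear_scale[OF sub])
  show "opt_value (u + u') (w + w') \<le> opt_value u w + opt_value u' w'"
    if "0 \<le> u" "0 \<le> w" "0 \<le> u'" "0 \<le> w'" for u w u' w'
    using that by (intro LIMSEQ_le[OF lim tendsto_add[OF lim lim]]) (auto intro: sublinear_add[OF sub])
  show "opt_value u w \<le> opt_value u' w'" if "0 \<le> u" "0 \<le> w" "u \<le> u'" "w \<le> w'" for u w u' w'
    using that by (intro LIMSEQ_le[OF lim lim]) (auto intro: sublinear_mono[OF sub])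
qed

text \<open>Dominated convergence carries the limit through the integral in \<open>wait\<close>, and
  the remaining operations are continuous. The images \<open>bellman (iterate n)\<close> are the
  shifted iterates, so they also tend to \<open>opt_value\<close>.\<close>

lemma bellman_opt:
  assumes u: "0 \<le> u" "0 \<le> w"
  shows "bellman opt_value u w = opt_value u w"
proof -
  let ?g = "\<lambda>G x. G (q0 x * u + p * q1 x * w) ((1 - p) * q1 x * w)"
  have "(\<lambda>n. \<integral>x. ?g (iterate n) x \<partial>M) \<longlonglongrightarrow> (\<integral>x. ?g opt_value x \<partial>M)"
  proof (rule integral_dominated_convergence)
    show "integrable M (\<lambda>x. value_bound * (q0 x * u + q1 x * w))"
      by simp
    show "AE x in M. (\<lambda>n. ?g (iterate n) x) \<longlonglongrightarrow> ?g opt_value x"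
      using u by (intro AE_I2 iterate_LIMSEQ wait_arguments_nonneg)
    show "AE x in M. norm (?g (iterate n) x) \<le> value_bound * (q0 x * u + q1 x * w)" for n
      using wait_integrand_bound[OF sublinear_iterate _ u]
        sublinear_nonneg[OF sublinear_iterate wait_arguments_nonneg] u
      by (intro AE_I2) auto
  qed (rule measurable_wait_integrand sublinear_iterate sublinear_opt)+
  then have "(\<lambda>n. bellman (iterate n) u w) \<longlonglongrightarrow> bellman opt_value u w"
    unfolding bellman_def wait_def repair_def using p by (intro tendsto_intros iterate_LIMSEQ) auto
  moreover have "(\<lambda>n. bellman (iterate n) u w) \<longlonglongrightarrow> opt_value u w"
    using LIMSEQ_Suc[OF iterate_LIMSEQ[OF u]] by simp
  ultimately show ?thesis
    by (rule LIMSEQ_unique)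
qed

section \<open>Threshold structure of the comparison between waiting and resetting\<close>

lemma wait_opt_sublevel:
  obtains bstar where "\<And>b. b \<in> {0..1} \<Longrightarrow> wait opt_value (1 - b) b \<le> repair opt_value \<longleftrightarrow> b \<le> bstar"
proof (cases "0 \<le> repair opt_value")
  case False
  have "\<not> wait opt_value (1 - b) b \<le> repair opt_value" if "b \<in> {0..1}" for b
    using False wait_nonneg[OF sublinear_opt, of "1 - b" b] that by auto
  \<comment> \<open>Resetting is never preferred here, so any threshold below all beliefs will
    do.\<close>
  then show ?thesis
    by (intro that[of "-1"]) auto
next
  case True
  let ?h = "\<lambda>b. wait opt_value (1 - b) b"
  let ?S = "{b \<in> {0..1}. ?h b \<le> repair opt_value}"
  \<comment> \<open>At belief 0 waiting yields no profit and leaves the belief at 0; homogeneity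
    takes the density \<open>q0 x\<close> out of the value, and it integrates to 1.\<close>
  have h0: "?h 0 = \<beta> * opt_value 1 0"
  proof -
    have "(\<integral>x. opt_value (q0 x) 0 \<partial>M) = (\<integral>x. q0 x * opt_value 1 0 \<partial>M)"
    proof (rule Bochner_Integration.integral_cong[OF refl])
      fix x assume "x \<in> space M"
      then show "opt_value (q0 x) 0 = q0 x * opt_value 1 0"
        using sublinear_scale[OF sublinear_opt, of 1 0 "q0 x"] Q_nonneg[of x] by simp
    qed
    then show ?thesis
      by (simp add: wait_def Q_integral)
  qed
  \<comment> \<open>If resetting were strictly worse at belief 0, then
    \<open>v = opt_value 1 0\<close> would satisfy \<open>v = \<beta> * v\<close>, hence
    \<open>v \<le> 0\<close>, and \<open>repair opt_value\<close> would be negative, contrary to the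
    case.\<close>
  have "opt_value 1 0 = max (\<beta> * opt_value 1 0) (repair opt_value)"
    using bellman_opt[of 1 0] h0 by (simp add: bellman_def)
  moreover have "\<beta> * opt_value 1 0 \<le> opt_value 1 0"
    using sublinear_nonneg[OF sublinear_opt, of 1 0] \<beta> by (simp add: mult_left_le_one_le)
  moreover have "opt_value 1 0 \<le> 0" if "\<beta> * opt_value 1 0 = opt_value 1 0"
    using that \<beta> by simp
  ultimately have h0_le: "?h 0 \<le> repair opt_value"
    using True h0 by (auto simp: max_def split: if_splits)
  then have S0: "0 \<in> ?S"
    by simp
  have bdd: "bdd_above ?S"
    by (rule bdd_aboveI[of _ 1]) auto
  define bstar where "bstar = Sup ?S"
  have bstar: "0 \<le> bstar" "bstar \<le> 1"
    unfolding bstar_def using cSup_upper[OF S0 bdd] S0 by (auto intro!: cSup_least)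
  \<comment> \<open>The supremum itself belongs to the sublevel set, as it is approached by points
    \<open>s\<close> of that set.\<close>
  have "?h bstar \<le> repair opt_value"
  proof (rule field_le_epsilon)
    fix e :: real assume e: "0 < e"
    \<comment> \<open>The summand 1 keeps the divisor positive when \<open>value_bound\<close> is
      0.\<close>
    define d where "d = e / (value_bound + 1)"
    have d: "0 < d" "d * value_bound \<le> e"
      using e value_bound_nonneg by (auto simp: d_def field_simps)
    then have "bstar - d < Sup ?S"
      by (simp add: bstar_def)
    then obtain s where s: "s \<in> ?S" "bstar - d < s"
      using less_cSupD[of ?S "bstar - d"] S0 by blast
    have "s \<le> bstar"
      unfolding bstar_def using cSup_upper[OF s(1) bdd] .
    \<comment> \<open>Raising the non-operational weight from \<open>1 - bstar\<close> to
      \<open>1 - s\<close> cannot lower the value; the extra operational weight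
      \<open>bstar - s\<close> is then split off and costs at most
      \<open>value_bound * (bstar - s)\<close>.\<close>
    have "?h bstar \<le> wait opt_value (1 - s + 0) (s + (bstar - s))"
      using \<open>s \<le> bstar\<close> bstar s by (intro wait_mono[OF sublinear_opt]) auto
    also have "\<dots> \<le> ?h s + wait opt_value 0 (bstar - s)"
      using \<open>s \<le> bstar\<close> s by (intro wait_add[OF sublinear_opt]) auto
    also have "wait opt_value 0 (bstar - s) \<le> value_bound * (0 + (bstar - s))"
      using \<open>s \<le> bstar\<close> by (intro wait_bound[OF sublinear_opt]) auto
    also have "\<dots> \<le> value_bound * d"
      using s value_bound_nonneg by (intro mult_left_mono) auto
    finally show "?h bstar \<le> repair opt_value + e"
      using s d by (simp add: mult.commute)
  qed
  \<comment> \<open>A convex function on the segment from 0 to \<open>bstar\<close> is at most the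
    larger of its endpoint values. The case \<open>bstar = 0\<close> is separate because
    \<open>b\<close> is expressed through the quotient \<open>b / bstar\<close>.\<close>
  moreover have "?h b \<le> ?h 0 \<or> ?h b \<le> ?h bstar" if b: "0 \<le> b" "b \<le> bstar" for b
  proof (cases "bstar = 0")
    case False
    define k where "k = b / bstar"
    have k: "0 \<le> k" "k \<le> 1" "b = k * bstar"
      using False b bstar by (auto simp: k_def)
    have "?h b = wait opt_value ((1 - k) * (1 - 0) + k * (1 - bstar)) ((1 - k) * 0 + k * bstar)"
      by (simp add: k algebra_simps)
    also have "\<dots> \<le> (1 - k) * ?h 0 + k * ?h bstar"
      unfolding wait_scale[OF sublinear_opt diff_ge_0_iff_ge[THEN iffD2, OF bstar(2)] bstar(1) k(1), symmetric]
      using k bstar wait_scale[OF sublinear_opt, of 1 0 "1 - k"]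
        wait_add[OF sublinear_opt, of "1 - k" 0 "k * (1 - bstar)" "k * bstar"] by simp
    also have "\<dots> \<le> max (?h 0) (?h bstar)"
      using k by (intro convex_bound_le) auto
    finally show ?thesis
      by linarith
  qed (use b in auto)
  ultimately have "?h b \<le> repair opt_value" if "0 \<le> b" "b \<le> bstar" for b
    using h0_le that order_trans by blast
  moreover have "b \<le> bstar" if "b \<in> ?S" for b
    unfolding bstar_def using cSup_upper[OF that bdd] .
  ultimately show ?thesis
    by (intro that[of bstar]) auto
qed

section \<open>Verification\<close>

lemmas model_assms = p X Q_nonneg Q_measurable Q_integral

definition belief_value :: "real \<Rightarrow> real" where
  "belief_value b = opt_value (1 - b) b"

text \<open>The action value in terms of the original belief update with its division; the lemmas
  below identify it with \<open>wait\<close> and \<open>repair\<close>.\<close>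

definition action_value :: "adr_action \<Rightarrow> real \<Rightarrow> real" where
  "action_value a b = expected_profit lam c a b +
     \<beta> * (\<integral>x. obs_density Q a b x * belief_value (next_belief p Q a x b) \<partial>M)"

lemma belief_value_range:
  assumes "b \<in> {0..1}"
  shows "0 \<le> belief_value b" "belief_value b \<le> value_bound"
  using sublinear_nonneg[OF sublinear_opt, of "1 - b" b] sublinear_bound[OF sublinear_opt, of "1 - b" b] assms
  by (auto simp: belief_value_def)

lemma measurable_belief_value [measurable]: "belief_value \<in> borel_measurable borel"
  using measurable_compose[OF _ sublinear_measurable[OF sublinear_opt], of "\<lambda>b. (1 - b, b)" borel]
  by (simp add: belief_value_def[abs_def])

text \<open>By homogeneity \<open>opt_value\<close> is the perspective of
  \<open>belief_value\<close>. At zero mass both sides vanish, whatever the default value of the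
  quotient.\<close>

lemma belief_value_perspective:
  assumes "0 \<le> u" "0 \<le> w"
  shows "(u + w) * belief_value (w / (u + w)) = opt_value u w"
proof (cases "u + w = 0")
  case True
  then have "u = 0" "w = 0"
    using assms by auto
  then show ?thesis
    using sublinear_scale[OF sublinear_opt, of 0 0 0] by simp
next
  case False
  have "1 - w / (u + w) = u / (u + w)"
    using False by (simp add: field_simps)
  moreover have "(u + w) * opt_value (u / (u + w)) (w / (u + w)) = opt_value u w"
    using False assms sublinear_scale[OF sublinear_opt, of "u / (u + w)" "w / (u + w)" "u + w"] by simp
  ultimately show ?thesis
    by (simp add: belief_value_def)
qed

text \<open>The density is the sum of the two weights that \<open>wait\<close> passes on, and the
  next belief is the operational weight divided by this sum, so the perspective identity cancels the
  division.\<close>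

lemma action_value_Do_Nothing:
  assumes b: "b \<in> {0..1}"
  shows "action_value Do_Nothing b = wait opt_value (1 - b) b"
proof -
  have eq: "obs_density Q Do_Nothing b x * belief_value (next_belief p Q Do_Nothing x b) =
      opt_value (q0 x * (1 - b) + p * q1 x * b) ((1 - p) * q1 x * b)" if "x \<in> space M" for x
  proof -
    have "obs_density Q Do_Nothing b x = (q0 x * (1 - b) + p * q1 x * b) + (1 - p) * q1 x * b"
      by (simp add: obs_density_def algebra_simps)
    moreover from this have "next_belief p Q Do_Nothing x b =
        (1 - p) * q1 x * b / ((q0 x * (1 - b) + p * q1 x * b) + (1 - p) * q1 x * b)"
      by (simp add: next_belief_def)
    ultimately show ?thesis
      using belief_value_perspective[OF wait_arguments_nonneg[OF that, of "1 - b" b]] b by simp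
  qed
  have "(\<integral>x. obs_density Q Do_Nothing b x * belief_value (next_belief p Q Do_Nothing x b) \<partial>M) =
      (\<integral>x. opt_value (q0 x * (1 - b) + p * q1 x * b) ((1 - p) * q1 x * b) \<partial>M)"
    by (intro Bochner_Integration.integral_cong refl eq)
  then show ?thesis
    by (simp add: action_value_def wait_def)
qed

lemma integral_obs_density: "(\<integral>x. obs_density Q a b x \<partial>M) = 1"
  by (simp add: obs_density_def Q_integral)

lemma integrable_obs_density [simp]: "integrable M (obs_density Q a b)"
  unfolding obs_density_def[abs_def] by simp

text \<open>A reset leads to the operational state with probability \<open>1 - p\<close> from either
  state, so the numerator of the update is \<open>1 - p\<close> times the density. At density 0 the
  update has the default value 0, but its weight in the integral is 0 as well.\<close>

lemma action_value_Reset: "action_value Reset b = repair opt_value"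
proof -
  have eq: "obs_density Q Reset b x * belief_value (next_belief p Q Reset x b) =
      obs_density Q Reset b x * opt_value p (1 - p)" for x
  proof -
    have "next_belief p Q Reset x b = (1 - p) * obs_density Q Reset b x / obs_density Q Reset b x"
      by (simp add: next_belief_def obs_density_def algebra_simps)
    then show ?thesis
      by (cases "obs_density Q Reset b x = 0") (simp_all add: belief_value_def)
  qed
  show ?thesis
    unfolding action_value_def repair_def eq by (simp add: integral_obs_density)
qed

text \<open>The fixed-point equation at total mass 1.\<close>

lemma belief_value_eq_max:
  "b \<in> {0..1} \<Longrightarrow> belief_value b = max (action_value Do_Nothing b) (action_value Reset b)"
  using bellman_opt[of "1 - b" b]
  by (simp add: action_value_Do_Nothing action_value_Reset belief_value_def bellman_def)

lemma action_value_le: "b \<in> {0..1} \<Longrightarrow> action_value a b \<le> belief_value b"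
  by (cases a) (simp_all add: belief_value_eq_max)

text \<open>The discounted gains telescope to the total profit minus the initial value, so optimality
  only needs the sign of each expected gain.\<close>

definition gain :: "real \<Rightarrow> nat \<Rightarrow> (nat \<Rightarrow> adr_action \<times> 'x) \<Rightarrow> real" where
  "gain b\<^sub>1 t \<omega> = expected_profit lam c (fst (\<omega> t)) (belief p Q b\<^sub>1 \<omega> t) +
     \<beta> * belief_value (belief p Q b\<^sub>1 \<omega> (Suc t)) - belief_value (belief p Q b\<^sub>1 \<omega> t)"

section \<open>Bounds, measurability and expectation of the gains\<close>

lemma expected_profit_abs:
  assumes "b \<in> {0..1}"
  shows "\<bar>expected_profit lam c a b\<bar> \<le> lam + c"
proof (cases a)
  case Do_Nothing
  then show ?thesis
    using assms lam c mult_left_le[of b lam] by auto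
qed (use lam c in auto)

text \<open>\<open>J\<close> stays general so that the same fact serves finite histories and whole
  trajectories.\<close>

lemma belief_in_unit:
  assumes "b\<^sub>1 \<in> {0..1}" "\<omega> \<in> space (PiM J (\<lambda>_. step_space X))" "{0..<t} \<subseteq> J"
  shows "belief p Q b\<^sub>1 \<omega> t \<in> {0..1}"
  using assms snd_PiM[OF model_assms assms(2)] by (intro belief_range[OF model_assms]) auto

text \<open>The discounted next value and the current value both lie between 0 and
  \<open>value_bound\<close>, so their difference contributes \<open>value_bound\<close> only
  once.\<close>

lemma gain_abs:
  assumes "b\<^sub>1 \<in> {0..1}" "\<omega> \<in> space (PiM J (\<lambda>_. step_space X))" "{0..<Suc t} \<subseteq> J"
  shows "\<bar>gain b\<^sub>1 t \<omega>\<bar> \<le> lam + c + value_bound"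
proof -
  have b: "belief p Q b\<^sub>1 \<omega> t \<in> {0..1}" "belief p Q b\<^sub>1 \<omega> (Suc t) \<in> {0..1}"
    using assms(3) by (intro belief_in_unit[OF assms(1,2)]; force)+
  have "0 \<le> \<beta> * belief_value (belief p Q b\<^sub>1 \<omega> (Suc t))"
    "\<beta> * belief_value (belief p Q b\<^sub>1 \<omega> (Suc t)) \<le> value_bound"
    using belief_value_range[OF b(2)] \<beta>
    by (simp_all add: order_trans[OF mult_left_le_one_le])
  then show ?thesis
    using expected_profit_abs[OF b(1), of "fst (\<omega> t)"] belief_value_range[OF b(1)]
    unfolding gain_def by linarith
qed

lemma measurable_gain:
  assumes J: "{0..<Suc t} \<subseteq> J"
  shows "gain b\<^sub>1 t \<in> borel_measurable (PiM J (\<lambda>_. step_space X))"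
proof -
  have [measurable]: "(\<lambda>\<omega>. belief p Q b\<^sub>1 \<omega> t) \<in> borel_measurable (PiM J (\<lambda>_. step_space X))"
    "(\<lambda>\<omega>. belief p Q b\<^sub>1 \<omega> (Suc t)) \<in> borel_measurable (PiM J (\<lambda>_. step_space X))"
    by (intro measurable_belief[OF model_assms]; use J in force)+
  have t: "(\<lambda>\<omega>. \<omega> t) \<in> measurable (PiM J (\<lambda>_. step_space X)) (step_space X)"
    by (rule measurable_component_singleton) (use J in auto)
  have [measurable]: "(\<lambda>\<omega>. profit lam c (fst (\<omega> t)) s) \<in> borel_measurable (PiM J (\<lambda>_. step_space X))" for s
    using measurable_compose[OF t measurable_step_space[of "\<lambda>a _. profit lam c a s" X]] by simp
  show ?thesis
    unfolding gain_def[abs_def] expected_profit_def by measurable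
qed

text \<open>The kernel is a density on the product of actions and observations, so Fubini separates
  the choice of the action from the observation.\<close>

lemma integral_step_measure:
  fixes g :: "adr_action \<Rightarrow> 'x \<Rightarrow> real"
  assumes \<omega>: "\<omega> \<in> space (PiM {0..<t} (\<lambda>_. step_space X))" and b: "b\<^sub>1 \<in> {0..1}"
    and g [measurable]: "\<And>a. g a \<in> borel_measurable M"
    and int: "\<And>a. integrable M (\<lambda>x. obs_density Q a (belief p Q b\<^sub>1 \<omega> t) x * g a x)"
  shows "(\<integral>z. g (fst z) (snd z) \<partial>step_measure p X Q \<pi> b\<^sub>1 t \<omega>) =
    (\<Sum>a\<in>UNIV. pmf (\<pi> t b\<^sub>1 \<omega>) a * (\<integral>x. obs_density Q a (belief p Q b\<^sub>1 \<omega> t) x * g a x \<partial>M))"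
proof -
  interpret M: sigma_finite_measure M
    by (rule sigma_finite_lebesgue_on[OF X])
  interpret A: sigma_finite_measure "count_space (UNIV :: adr_action set)"
    by (rule sigma_finite_measure_count_space_finite[OF finite_adr_action])
  interpret pair_sigma_finite "count_space (UNIV :: adr_action set)" M ..
  let ?b = "belief p Q b\<^sub>1 \<omega> t" and ?\<pi> = "pmf (\<pi> t b\<^sub>1 \<omega>)"
  have b': "?b \<in> {0..1}"
    using belief_in_unit[OF b \<omega>] by simp
  let ?d = "\<lambda>a x. ?\<pi> a * obs_density Q a ?b x"
  have [measurable]: "obs_density Q a ?b \<in> borel_measurable M" for a
    by (rule borel_measurable_integrable) simp
  have d [measurable]: "(\<lambda>z. ?d (fst z) (snd z)) \<in> borel_measurable (step_space X)"
    by (rule measurable_step_space) measurable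
  have g' [measurable]: "(\<lambda>z. g (fst z) (snd z)) \<in> borel_measurable (step_space X)"
    by (rule measurable_step_space) measurable
  have "(\<integral>z. g (fst z) (snd z) \<partial>step_measure p X Q \<pi> b\<^sub>1 t \<omega>) =
      (\<integral>z. ?d (fst z) (snd z) * g (fst z) (snd z) \<partial>step_space X)"
    unfolding step_measure_def case_prod_beta
    by (subst integral_density)
       (auto intro!: mult_nonneg_nonneg obs_density_nonneg[OF model_assms b'])
  also have "\<dots> = (\<integral>a. (\<integral>x. ?d a x * g a x \<partial>M) \<partial>count_space UNIV)"
  proof -
    \<comment> \<open>The action set is finite, so integrability of each section gives integrability
      on the product.\<close>
    have "integrable (count_space UNIV \<Otimes>\<^sub>M M) (\<lambda>z. ?d (fst z) (snd z) * g (fst z) (snd z))"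
    proof (rule Fubini_integrable)
      show "(\<lambda>z. ?d (fst z) (snd z) * g (fst z) (snd z)) \<in> borel_measurable (count_space UNIV \<Otimes>\<^sub>M M)"
        using borel_measurable_times[OF d g'] unfolding step_space_def .
      show "AE a in count_space UNIV.
          integrable M (\<lambda>x. ?d (fst (a, x)) (snd (a, x)) * g (fst (a, x)) (snd (a, x)))"
        using int by (simp add: mult.assoc)
    qed (rule integrable_count_space[OF finite_adr_action])
    from integral_fst'[OF this] show ?thesis
      by (simp add: step_space_def)
  qed
  also have "\<dots> = (\<Sum>a\<in>UNIV. ?\<pi> a * (\<integral>x. obs_density Q a ?b x * g a x \<partial>M))"
    by (simp add: lebesgue_integral_count_space_finite[OF finite_adr_action] mult.assoc)
  finally show ?thesis .
qed

text \<open>Averaging over the observation turns the gain into the advantage of the action, its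
  action value minus the current belief value; the policy then weights these advantages.\<close>

lemma integral_gain_step:
  assumes \<omega>: "\<omega> \<in> space (PiM {0..<t} (\<lambda>_. step_space X))" and b: "b\<^sub>1 \<in> {0..1}"
  shows "(\<integral>z. gain b\<^sub>1 t (fun_upd \<omega> t z) \<partial>step_measure p X Q \<pi> b\<^sub>1 t \<omega>) =
    (\<Sum>a\<in>UNIV. pmf (\<pi> t b\<^sub>1 \<omega>) a *
       (action_value a (belief p Q b\<^sub>1 \<omega> t) - belief_value (belief p Q b\<^sub>1 \<omega> t)))"
proof -
  let ?b = "belief p Q b\<^sub>1 \<omega> t"
  let ?r = "\<lambda>a. expected_profit lam c a ?b - belief_value ?b"
  \<comment> \<open>The gain as a function of the newest action and observation; \<open>?r\<close>
    collects the terms free of the observation, which the density integrates to themselves.\<close>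
  define g where "g a x = ?r a + \<beta> * belief_value (next_belief p Q a x ?b)" for a x
  have b': "?b \<in> {0..1}"
    using belief_in_unit[OF b \<omega>] by simp
  have [measurable]: "(\<lambda>x. next_belief p Q a x ?b) \<in> borel_measurable M" for a
    unfolding next_belief_def obs_density_def by measurable
  have [measurable]: "obs_density Q a ?b \<in> borel_measurable M" for a
    by (rule borel_measurable_integrable) simp
  have int: "integrable M (\<lambda>x. obs_density Q a ?b x * belief_value (next_belief p Q a x ?b))" for a
  proof (rule Bochner_Integration.integrable_bound)
    show "integrable M (\<lambda>x. obs_density Q a ?b x * value_bound)"
      by simp
    show "AE x in M. norm (obs_density Q a ?b x * belief_value (next_belief p Q a x ?b)) \<le>
        norm (obs_density Q a ?b x * value_bound)"
    proof (rule AE_I2)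
      fix x assume x: "x \<in> space M"
      have "next_belief p Q a x ?b \<in> {0..1}"
        by (rule next_belief_range[OF model_assms b']) (use x in simp_all)
      from belief_value_range[OF this] show "norm (obs_density Q a ?b x * belief_value (next_belief p Q a x ?b)) \<le>
          norm (obs_density Q a ?b x * value_bound)"
        by (auto simp: abs_mult intro!: mult_left_mono)
    qed
  qed measurable
  have split: "(\<lambda>x. obs_density Q a ?b x * g a x) = (\<lambda>x. ?r a * obs_density Q a ?b x +
      \<beta> * (obs_density Q a ?b x * belief_value (next_belief p Q a x ?b)))" for a
    by (auto simp: g_def algebra_simps)
  have eq: "(\<integral>x. obs_density Q a ?b x * g a x \<partial>M) = action_value a ?b - belief_value ?b" for a
    unfolding split using int by (simp add: integral_obs_density action_value_def)
  \<comment> \<open>The belief at \<open>t\<close> reads only entries below \<open>t\<close>, so the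
    update at \<open>t\<close> leaves it unchanged.\<close>
  have belief_upd: "belief p Q b\<^sub>1 (fun_upd \<omega> t z) t = ?b" for z
    by (rule belief_cong) simp
  have "gain b\<^sub>1 t (fun_upd \<omega> t z) = g (fst z) (snd z)" for z
    by (simp add: gain_def g_def belief_upd)
  then have "(\<integral>z. gain b\<^sub>1 t (fun_upd \<omega> t z) \<partial>step_measure p X Q \<pi> b\<^sub>1 t \<omega>) =
      (\<integral>z. g (fst z) (snd z) \<partial>step_measure p X Q \<pi> b\<^sub>1 t \<omega>)"
    by simp
  also have "\<dots> = (\<Sum>a\<in>UNIV. pmf (\<pi> t b\<^sub>1 \<omega>) a * (\<integral>x. obs_density Q a ?b x * g a x \<partial>M))"
  proof (rule integral_step_measure[OF \<omega> b])
    show "g a \<in> borel_measurable M" for a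
      unfolding g_def[abs_def] by measurable
    show "integrable M (\<lambda>x. obs_density Q a ?b x * g a x)" for a
      unfolding split using int by simp
  qed
  finally show ?thesis
    by (simp add: eq)
qed

text \<open>Conditionally on the history, the expected gain averages the advantages of the actions,
  none of which is positive. They vanish on the support of a policy that chooses only maximizing
  actions.\<close>

lemma
  assumes \<pi>: "\<pi> \<in> policies X" and b: "b\<^sub>1 \<in> {0..1}"
  shows integral_gain_nonpos: "(\<integral>\<omega>. gain b\<^sub>1 t \<omega> \<partial>trajectory_measure p X Q \<pi> b\<^sub>1) \<le> 0"
    and integral_gain_zero: "(\<And>\<omega> a. \<omega> \<in> space (PiM {0..<t} (\<lambda>_. step_space X)) \<Longrightarrow> a \<in> set_pmf (\<pi> t b\<^sub>1 \<omega>) \<Longrightarrow>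
        action_value a (belief p Q b\<^sub>1 \<omega> t) = belief_value (belief p Q b\<^sub>1 \<omega> t)) \<Longrightarrow>
      (\<integral>\<omega>. gain b\<^sub>1 t \<omega> \<partial>trajectory_measure p X Q \<pi> b\<^sub>1) = 0"
proof -
  interpret IT: Ionescu_Tulcea "step_measure p X Q \<pi> b\<^sub>1" "\<lambda>_. step_space X"
    by (rule Ionescu_Tulcea_step_measure[OF model_assms \<pi> b])
  let ?b = "\<lambda>\<omega>. belief p Q b\<^sub>1 \<omega> t"
  let ?C = "IT.C 0 t (\<lambda>_. undefined)"
  have space_C: "space ?C = space (PiM {0..<t} (\<lambda>_. step_space X))"
    by (subst IT.space_C) (auto simp: space_PiM)
  have "(\<integral>\<omega>. gain b\<^sub>1 t \<omega> \<partial>trajectory_measure p X Q \<pi> b\<^sub>1) =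
      (\<integral>\<omega>. (\<integral>z. gain b\<^sub>1 t (fun_upd \<omega> t z) \<partial>step_measure p X Q \<pi> b\<^sub>1 t \<omega>) \<partial>?C)"
    unfolding trajectory_measure_def
  proof (rule IT.integral_lim_Suc)
    \<comment> \<open>The gain at \<open>t\<close> involves the action at \<open>t\<close> and
      beliefs up to index \<open>Suc t\<close>, hence only the coordinates below
      \<open>Suc t\<close>.\<close>
    show "gain b\<^sub>1 t (restrict \<omega> {0..<Suc t}) = gain b\<^sub>1 t \<omega>" for \<omega>
    proof -
      have "belief p Q b\<^sub>1 (restrict \<omega> {0..<Suc t}) n = belief p Q b\<^sub>1 \<omega> n" if "n \<le> Suc t" for n
        using that by (intro belief_cong) auto
      from this[of t] this[of "Suc t"] show ?thesis
        by (simp add: gain_def del: belief.simps)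
    qed
  qed (rule measurable_gain gain_abs[OF b] subset_refl | assumption)+
  also have "\<dots> = (\<integral>\<omega>. (\<Sum>a\<in>UNIV. pmf (\<pi> t b\<^sub>1 \<omega>) a * (action_value a (?b \<omega>) - belief_value (?b \<omega>))) \<partial>?C)"
    by (intro Bochner_Integration.integral_cong refl integral_gain_step b) (simp add: space_C)
  finally have eq: "(\<integral>\<omega>. gain b\<^sub>1 t \<omega> \<partial>trajectory_measure p X Q \<pi> b\<^sub>1) = \<dots>" .
  \<comment> \<open>Passing to the negated integrand lets the sign follow from pointwise
    nonnegativity.\<close>
  have "0 \<le> (\<integral>\<omega>. - (\<Sum>a\<in>UNIV. pmf (\<pi> t b\<^sub>1 \<omega>) a * (action_value a (?b \<omega>) - belief_value (?b \<omega>))) \<partial>?C)"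
  proof (rule integral_nonneg_AE, rule AE_I2)
    fix \<omega> assume "\<omega> \<in> space ?C"
    then have "?b \<omega> \<in> {0..1}"
      by (intro belief_in_unit[OF b]) (auto simp: space_C)
    then show "0 \<le> - (\<Sum>a\<in>UNIV. pmf (\<pi> t b\<^sub>1 \<omega>) a * (action_value a (?b \<omega>) - belief_value (?b \<omega>)))"
      by (auto intro!: sum_nonpos mult_nonneg_nonpos action_value_le)
  qed
  then show "(\<integral>\<omega>. gain b\<^sub>1 t \<omega> \<partial>trajectory_measure p X Q \<pi> b\<^sub>1) \<le> 0"
    unfolding eq by simp
  assume greedy: "\<And>\<omega> a. \<omega> \<in> space (PiM {0..<t} (\<lambda>_. step_space X)) \<Longrightarrow> a \<in> set_pmf (\<pi> t b\<^sub>1 \<omega>) \<Longrightarrow>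
    action_value a (?b \<omega>) = belief_value (?b \<omega>)"
  have "(\<Sum>a\<in>UNIV. pmf (\<pi> t b\<^sub>1 \<omega>) a * (action_value a (?b \<omega>) - belief_value (?b \<omega>))) = 0"
    if "\<omega> \<in> space ?C" for \<omega>
    using greedy[of \<omega>] that by (intro sum.neutral) (auto simp: space_C set_pmf_iff)
  then show "(\<integral>\<omega>. gain b\<^sub>1 t \<omega> \<partial>trajectory_measure p X Q \<pi> b\<^sub>1) = 0"
    unfolding eq by (simp cong: Bochner_Integration.integral_cong)
qed

section \<open>Telescoping of the gains and optimality\<close>

lemma total_profit_decomposition:
  assumes \<pi>: "\<pi> \<in> policies X" and b: "b\<^sub>1 \<in> {0..1}"
  shows "(\<lambda>t. \<beta> ^ t * (\<integral>\<omega>. gain b\<^sub>1 t \<omega> \<partial>trajectory_measure p X Q \<pi> b\<^sub>1)) sums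
    (total_profit lam c p \<beta> X Q \<pi> b\<^sub>1 - belief_value b\<^sub>1)"
proof -
  interpret IT: Ionescu_Tulcea "step_measure p X Q \<pi> b\<^sub>1" "\<lambda>_. step_space X"
    by (rule Ionescu_Tulcea_step_measure[OF model_assms \<pi> b])
  let ?T = "trajectory_measure p X Q \<pi> b\<^sub>1"
  let ?r = "\<lambda>t \<omega>. expected_profit lam c (fst (\<omega> t)) (belief p Q b\<^sub>1 \<omega> t)"
  let ?v = "\<lambda>t \<omega>. belief_value (belief p Q b\<^sub>1 \<omega> t)"
  let ?B = "lam + c + value_bound"
  interpret T: prob_space ?T
    unfolding trajectory_measure_def by (rule IT.prob_space_lim)
  have sets_T: "sets ?T = sets (PiM UNIV (\<lambda>_. step_space X))"
    and space_T: "space ?T = space (PiM UNIV (\<lambda>_. step_space X))"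
    by (simp_all add: trajectory_measure_def)
  have gain_T: "gain b\<^sub>1 t \<in> borel_measurable ?T" for t
    unfolding measurable_cong_sets[OF sets_T refl] by (rule measurable_gain) simp
  have bound: "\<bar>gain b\<^sub>1 t \<omega>\<bar> \<le> ?B" if "\<omega> \<in> space ?T" for t \<omega>
    using that by (intro gain_abs[OF b]) (auto simp: space_T)
  have geometric: "summable (\<lambda>t. \<beta> ^ t * C)" for C
    using \<beta> by (intro summable_mult2 summable_geometric) simp
  have int: "integrable ?T (\<lambda>\<omega>. \<beta> ^ t * gain b\<^sub>1 t \<omega>)" for t
    using bound gain_T by (intro integrable_mult_right T.integrable_const_bound[of _ ?B]) auto
  \<comment> \<open>The identity holds along every trajectory, before expectations are taken: the
    value terms of consecutive discounted gains cancel, leaving the initial one.\<close>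
  have pointwise: "(\<Sum>t. \<beta> ^ t * ?r t \<omega>) = belief_value b\<^sub>1 + (\<Sum>t. \<beta> ^ t * gain b\<^sub>1 t \<omega>)"
    if \<omega>: "\<omega> \<in> space ?T" for \<omega>
  proof -
    have bel: "belief p Q b\<^sub>1 \<omega> t \<in> {0..1}" for t
      using \<omega> by (intro belief_in_unit[OF b, of _ UNIV]) (auto simp: space_T)
    have "summable (\<lambda>t. \<beta> ^ t * ?r t \<omega>)"
    proof (rule summable_comparison_test[OF _ geometric[of "lam + c"]])
      show "\<exists>N. \<forall>n\<ge>N. norm (\<beta> ^ n * ?r n \<omega>) \<le> \<beta> ^ n * (lam + c)"
        using expected_profit_abs[OF bel] \<beta> by (auto simp: abs_mult intro!: mult_left_mono)
    qed
    then have r: "(\<lambda>t. \<beta> ^ t * ?r t \<omega>) sums (\<Sum>t. \<beta> ^ t * ?r t \<omega>)"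
      by (rule summable_sums)
    \<comment> \<open>The boundary term of the telescoping sum vanishes because values are bounded
      and discounted.\<close>
    have "(\<lambda>t. \<beta> ^ t * ?v t \<omega>) \<longlonglongrightarrow> 0"
    proof (rule Lim_null_comparison[OF _ summable_LIMSEQ_zero[OF geometric[of value_bound]]])
      show "\<forall>\<^sub>F t in sequentially. norm (\<beta> ^ t * ?v t \<omega>) \<le> \<beta> ^ t * value_bound"
        using belief_value_range[OF bel] \<beta> by (auto simp: abs_mult intro!: mult_left_mono always_eventually)
    qed
    from sums_add[OF r telescope_sums[OF this]]
    have "(\<lambda>t. \<beta> ^ t * ?r t \<omega> + (\<beta> ^ Suc t * ?v (Suc t) \<omega> - \<beta> ^ t * ?v t \<omega>)) sums
        ((\<Sum>t. \<beta> ^ t * ?r t \<omega>) - belief_value b\<^sub>1)"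
      by simp
    also have "(\<lambda>t. \<beta> ^ t * ?r t \<omega> + (\<beta> ^ Suc t * ?v (Suc t) \<omega> - \<beta> ^ t * ?v t \<omega>)) =
        (\<lambda>t. \<beta> ^ t * gain b\<^sub>1 t \<omega>)"
      by (auto simp: gain_def algebra_simps simp del: belief.simps)
    finally show ?thesis
      by (simp add: sums_iff)
  qed
  have norm_le: "norm (\<beta> ^ t * gain b\<^sub>1 t \<omega>) \<le> \<beta> ^ t * ?B" if "\<omega> \<in> space ?T" for t \<omega>
    using bound[OF that] \<beta> by (auto simp: abs_mult intro!: mult_left_mono)
  \<comment> \<open>The geometric majorant gives the two summability conditions under which sum and
    expectation may be exchanged.\<close>
  have summable_AE: "AE \<omega> in ?T. summable (\<lambda>t. norm (\<beta> ^ t * gain b\<^sub>1 t \<omega>))"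
    using norm_le by (intro AE_I2 summable_comparison_test[OF _ geometric[of ?B]]) auto
  have summable_int: "summable (\<lambda>t. \<integral>\<omega>. norm (\<beta> ^ t * gain b\<^sub>1 t \<omega>) \<partial>?T)"
  proof (rule summable_comparison_test[OF _ geometric[of ?B]])
    have "(\<integral>\<omega>. norm (\<beta> ^ t * gain b\<^sub>1 t \<omega>) \<partial>?T) \<le> \<beta> ^ t * ?B" for t
      using T.integral_le_const[OF integrable_norm[OF int]] norm_le by auto
    then show "\<exists>N. \<forall>t\<ge>N. norm (\<integral>\<omega>. norm (\<beta> ^ t * gain b\<^sub>1 t \<omega>) \<partial>?T) \<le> \<beta> ^ t * ?B"
      by (simp add: integral_nonneg_AE)
  qed
  have "total_profit lam c p \<beta> X Q \<pi> b\<^sub>1 = (\<integral>\<omega>. belief_value b\<^sub>1 + (\<Sum>t. \<beta> ^ t * gain b\<^sub>1 t \<omega>) \<partial>?T)"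
    unfolding total_profit_def by (intro Bochner_Integration.integral_cong refl pointwise)
  also have "\<dots> = belief_value b\<^sub>1 + (\<integral>\<omega>. (\<Sum>t. \<beta> ^ t * gain b\<^sub>1 t \<omega>) \<partial>?T)"
    using integrable_suminf[OF int summable_AE summable_int] by (simp add: T.prob_space)
  finally show ?thesis
    using sums_integral[OF int summable_AE summable_int] by simp
qed

text \<open>\<open>belief_value\<close> bounds the profit of every policy because expected gains are
  never positive, and the threshold policy attains it because its expected gains are zero.\<close>

lemma optimal_threshold_policy:
  "\<exists>bstar. optimal_policy lam c p \<beta> X Q
     (stationary_policy p Q (\<lambda>b. if b \<le> bstar then Reset else Do_Nothing))"
proof -
  obtain bstar where bstar: "\<And>b. b \<in> {0..1} \<Longrightarrow> wait opt_value (1 - b) b \<le> repair opt_value \<longleftrightarrow> b \<le> bstar"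
    using wait_opt_sublevel by blast
  let ?\<pi> = "stationary_policy p Q (\<lambda>b. if b \<le> bstar then Reset else Do_Nothing)"
  have \<pi>: "?\<pi> \<in> policies X"
    by (rule stationary_policy_in_policies[OF model_assms]) measurable
  have "total_profit lam c p \<beta> X Q \<pi>' b\<^sub>1 \<le> total_profit lam c p \<beta> X Q ?\<pi> b\<^sub>1"
    if b: "b\<^sub>1 \<in> {0..1}" and \<pi>': "\<pi>' \<in> policies X" for b\<^sub>1 \<pi>'
  proof -
    have "(\<lambda>t. \<beta> ^ t * (\<integral>\<omega>. gain b\<^sub>1 t \<omega> \<partial>trajectory_measure p X Q \<pi>' b\<^sub>1)) sums
        (total_profit lam c p \<beta> X Q \<pi>' b\<^sub>1 - belief_value b\<^sub>1)"
      by (rule total_profit_decomposition[OF \<pi>' b])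
    moreover have "\<beta> ^ t * (\<integral>\<omega>. gain b\<^sub>1 t \<omega> \<partial>trajectory_measure p X Q \<pi>' b\<^sub>1) \<le> 0" for t
      using integral_gain_nonpos[OF \<pi>' b, of t] \<beta> by (intro mult_nonneg_nonpos) auto
    ultimately have "total_profit lam c p \<beta> X Q \<pi>' b\<^sub>1 - belief_value b\<^sub>1 \<le> 0"
      by (rule sums_le[OF _ _ sums_zero, rotated])
    moreover have "(\<integral>\<omega>. gain b\<^sub>1 t \<omega> \<partial>trajectory_measure p X Q ?\<pi> b\<^sub>1) = 0" for t
    proof (rule integral_gain_zero[OF \<pi> b])
      fix \<omega> a
      assume \<omega>: "\<omega> \<in> space (PiM {0..<t} (\<lambda>_. step_space X))" and a: "a \<in> set_pmf (?\<pi> t b\<^sub>1 \<omega>)"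
      have bel: "belief p Q b\<^sub>1 \<omega> t \<in> {0..1}"
        by (rule belief_in_unit[OF b \<omega> subset_refl])
      \<comment> \<open>At beliefs up to \<open>bstar\<close> waiting is worth at most a reset,
        above it more, so the prescribed action attains the maximum; ties go to
        \<open>Reset\<close>.\<close>
      show "action_value a (belief p Q b\<^sub>1 \<omega> t) = belief_value (belief p Q b\<^sub>1 \<omega> t)"
        using a bstar[OF bel] unfolding belief_value_eq_max[OF bel]
        by (auto simp: stationary_policy_def action_value_Do_Nothing[OF bel] action_value_Reset
            split: if_splits)
    qed
    then have "total_profit lam c p \<beta> X Q ?\<pi> b\<^sub>1 - belief_value b\<^sub>1 = 0"
      using total_profit_decomposition[OF \<pi> b] by (simp add: sums_iff)
    ultimately show ?thesis
      by simp
  qed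
  then show ?thesis
    using \<pi> unfolding optimal_policy_def by blast
qed

end

theorem theorem1:
  fixes lam c p \<beta> :: real
    and X :: "(real ^ 'm) set"
    and Q :: "adr_state \<Rightarrow> adr_action \<Rightarrow> real ^ 'm \<Rightarrow> real"
  assumes "0 \<le> lam" and "0 \<le> c" and "0 \<le> p" and "p \<le> 1" and "0 < \<beta>" and "\<beta> < 1"
    and "X \<in> sets lebesgue"
    and "\<And>s a x. x \<in> X \<Longrightarrow> 0 \<le> Q s a x"
    and "\<And>s a. Q s a \<in> borel_measurable (lebesgue_on X)"
    and "\<And>s a. (\<integral>x. Q s a x \<partial>lebesgue_on X) = 1"
  shows "\<exists>bstar::real. optimal_policy lam c p \<beta> X Q
           (stationary_policy p Q (\<lambda>b. if b \<le> bstar then Reset else Do_Nothing))"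
proof -
  interpret adr_maintenance lam c p \<beta> X Q
    by unfold_locales (fact assms)+
  show ?thesis
    by (rule optimal_threshold_policy)
qed

end
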